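(* There exist constants $c>0$ and $n_0$ such that for every $n\ge n_0$ and every integer smoothing factor $1\le k\le\sqrt n$, the following holds: for the flooding process with source node $1$ on the $k$-smoothed $n$-vertex spooling graph (smoothed with respect to $\mathcal G_{conn}$), with probability at least $1/2$ the flooding process does not complete before round $c\,n^{2/3}/k^{1/3}$.
   Context: Graphs are simple and undirected on a node set $V$ with $|V|=n$. A dynamic graph is a sequence $G_1,G_2,\dots$ of graphs on $V$, where $G_r$ is the graph in round $r$. Smoothing: the edit distance between two graphs on $V$ is the minimum number of edge additions and removals transforming one into the other. $\mathcal G_{conn}$ is the set of all dynamic graphs in which every individual graph is connected. To $k$-smooth a dynamic graph in $\mathcal G_{conn}$ (with respect to $\mathcal G_{conn}$) is to replace each of its graphs $G_r$, independently over $r$, by a graph sampled uniformly at random from all connected graphs on $V$ at edit distance at most $k$ from $G_r$. Flooding: a single source node starts with a message. In every round, every node that knows the message sends it to all its neighbors in that round's (smoothed) graph, which receive it. The process completes in the first round after which every node has the message. Spooling graph: label the nodes $1,\dots,n$, with node $1$ the source. For $i\in\{1,\dots,n-1\}$, the $i$-spool graph consists of a star on $\{1,\dots,i\}$ centered at $i$, a star on $\{i+1,\dots,n\}$ centered at $i+1$, and an edge between $i$ and $i+1$. The spooling graph is the dynamic graph whose graph in each round $r\ge1$ is the $\min\{r,n-1\}$-spool graph. *)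

theory Defs
  imports "HOL-Probability.Probability"
begin

text \<open>A graph on a fixed node set \<open>V\<close> is represented by its set of edges, each edge being a
  two-element subset of \<open>V\<close>. A dynamic graph is a function from rounds to graphs; rounds are
  numbered from 1, and the value at 0 is never used.\<close>

type_synonym 'a graph = "'a set set"
type_synonym 'a dynamic_graph = "nat \<Rightarrow> 'a graph"

definition all_edges :: "'a set \<Rightarrow> 'a graph" where
  "all_edges V = {e. e \<subseteq> V \<and> card e = 2}"

definition adj :: "'a graph \<Rightarrow> ('a \<times> 'a) set" where
  "adj E = {(u, v). {u, v} \<in> E}"

definition connected_graphs :: "'a set \<Rightarrow> 'a graph set" where
  "connected_graphs V = {E. E \<subseteq> all_edges V \<and> (\<forall>u\<in>V. \<forall>v\<in>V. (u, v) \<in> (adj E)\<^sup>*)}"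

definition single_edit :: "'a set \<Rightarrow> ('a graph \<times> 'a graph) set" where
  "single_edit V = {(E, F). \<exists>e\<in>all_edges V.
     (e \<notin> E \<and> F = insert e E) \<or> (e \<in> E \<and> F = E - {e})}"

definition edit_distance :: "'a set \<Rightarrow> 'a graph \<Rightarrow> 'a graph \<Rightarrow> nat" where
  "edit_distance V E F = (LEAST m. (E, F) \<in> single_edit V ^^ m)"

text \<open>Every value \<open>G r\<close> with \<open>r \<ge> 1\<close> is meant to be a connected graph on the finite set \<open>V\<close>,
  so that it lies in \<open>smoothing_ball V k (G r)\<close> and the uniform distribution on that finite set
  is well defined. The product measure makes the rounds independent.\<close>

definition smoothing_ball :: "'a set \<Rightarrow> nat \<Rightarrow> 'a graph \<Rightarrow> 'a graph set" where
  "smoothing_ball V k E = {F \<in> connected_graphs V. edit_distance V E F \<le> k}"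

definition smoothed :: "'a set \<Rightarrow> nat \<Rightarrow> 'a dynamic_graph \<Rightarrow> 'a dynamic_graph measure" where
  "smoothed V k G = (\<Pi>\<^sub>M r\<in>{1..}. measure_pmf (pmf_of_set (smoothing_ball V k (G r))))"

text \<open>\<open>informed s H r\<close> is the set of nodes that know the message after round \<open>r\<close>.\<close>

fun informed :: "'a \<Rightarrow> 'a dynamic_graph \<Rightarrow> nat \<Rightarrow> 'a set" where
  "informed s H 0 = {s}"
| "informed s H (Suc r) = informed s H r \<union> {v. \<exists>u\<in>informed s H r. {u, v} \<in> H (Suc r)}"

definition completes_in_round :: "'a set \<Rightarrow> 'a \<Rightarrow> 'a dynamic_graph \<Rightarrow> nat \<Rightarrow> bool" where
  "completes_in_round V s H r \<longleftrightarrow> r \<ge> 1 \<and> V \<subseteq> informed s H r \<and>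
     (\<forall>r'\<in>{1..<r}. \<not> V \<subseteq> informed s H r')"

definition completes_before :: "'a set \<Rightarrow> 'a \<Rightarrow> 'a dynamic_graph \<Rightarrow> real \<Rightarrow> bool" where
  "completes_before V s H T \<longleftrightarrow> (\<exists>r. completes_in_round V s H r \<and> real r < T)"

definition star :: "'a set \<Rightarrow> 'a \<Rightarrow> 'a graph" where
  "star S c = {{c, v} | v. v \<in> S - {c}}"

definition spool :: "nat \<Rightarrow> nat \<Rightarrow> nat graph" where
  "spool n i = star {1..i} i \<union> star {i+1..n} (i+1) \<union> {{i, i+1}}"

definition spooling_graph :: "nat \<Rightarrow> nat dynamic_graph" where
  "spooling_graph n r = spool n (min r (n - 1))"

end

theory Submission
  imports Defs
begin

text \<open>As long as the right-hand center \<open>r + 1\<close> of the \<open>r\<close>-spool is uninformed at the start of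
  round \<open>r\<close>, the spool edges inform no node beyond \<open>r + 1\<close>. Any other newly informed node
  is reached along an edge inserted by the smoothing. Such an edge is present with probability
  \<open>p = O(k / n\<^sup>2)\<close>, by a switching argument: replace it by other new edges, and, if it is a bridge,
  also restore a removed tree edge. Since \<open>T n p = O(1)\<close> for \<open>T = c n\<^sup>2\<^sup>/\<^sup>3 / k\<^sup>1\<^sup>/\<^sup>3\<close> and
  \<open>k \<le> \<surd>n\<close>, on average \<open>O(T)\<close> nodes are reached up to time \<open>T\<close>. Hence a given
  later center has been reached early with probability \<open>O(T\<^sup>2 p)\<close>, and some such center with
  probability \<open>O(T\<^sup>3 p) = O(c\<^sup>3)\<close>.\<close>

subsection \<open>Edit distance\<close>

lemma finite_all_edges: "finite V \<Longrightarrow> finite (all_edges V)"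
  unfolding all_edges_def by (rule finite_subset[of _ "Pow V"]) auto

lemma card_sym_diff_single_edit:
  assumes "finite (sym_diff E F)" "(F, F') \<in> single_edit V"
  shows "finite (sym_diff E F') \<and> card (sym_diff E F') \<le> Suc (card (sym_diff E F))"
proof -
  obtain e where "sym_diff E F' \<subseteq> insert e (sym_diff E F)"
    using assms(2) unfolding single_edit_def by fastforce
  then have "finite (sym_diff E F')" "card (sym_diff E F') \<le> card (insert e (sym_diff E F))"
    using assms(1) finite_subset card_mono[of "insert e (sym_diff E F)"] by auto
  then show ?thesis
    using assms(1) card_insert_if[OF assms(1), of e] by (auto split: if_splits)
qed

lemma card_sym_diff_le_edits:
  "(E, F) \<in> single_edit V ^^ m \<Longrightarrow> finite (sym_diff E F) \<and> card (sym_diff E F) \<le> m"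
proof (induction m arbitrary: F)
  case (Suc m)
  then obtain F0 where "(E, F0) \<in> single_edit V ^^ m" "(F0, F) \<in> single_edit V" by auto
  then show ?case
    using Suc.IH[of F0] card_sym_diff_single_edit[of E F0 F V] by simp
qed simp

lemma edits_of_card_sym_diff:
  assumes "finite V" "E \<subseteq> all_edges V" "F \<subseteq> all_edges V"
  shows "(E, F) \<in> single_edit V ^^ card (sym_diff E F)"
  using assms(3)
proof (induction "card (sym_diff E F)" arbitrary: F)
  case 0
  have "finite (sym_diff E F)"
    using finite_all_edges[OF assms(1)] assms(2) 0(2) by (meson finite_Diff finite_UnI finite_subset)
  then show ?case using 0 by auto
next
  case (Suc m)
  have fin: "finite (sym_diff E F)"
    using finite_all_edges[OF assms(1)] assms(2) Suc(3) by (meson finite_Diff finite_UnI finite_subset)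
  have "sym_diff E F \<noteq> {}" using Suc(2) by (metis card.empty nat.distinct(1))
  then obtain e where e: "e \<in> sym_diff E F" by blast
  \<comment> \<open>Toggling \<open>e\<close> moves \<open>F\<close> one edit closer to
    \<open>E\<close>; undoing the toggle becomes the last edit of the path.\<close>
  define F0 where "F0 = (if e \<in> F then F - {e} else insert e F)"
  have "sym_diff E F0 = sym_diff E F - {e}" using e unfolding F0_def by auto
  then have "card (sym_diff E F0) = m" using Suc(2) e fin by simp
  moreover have sub: "F0 \<subseteq> all_edges V" using Suc(3) e assms(2) unfolding F0_def by auto
  ultimately have "(E, F0) \<in> single_edit V ^^ m" using Suc.hyps(1)[of F0] by simp
  moreover have "(F0, F) \<in> single_edit V"
    using e Suc(3) assms(2) unfolding single_edit_def F0_def by auto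
  ultimately show ?case using Suc(2) by (metis relpow_Suc_I)
qed

text \<open>The two preceding lemmas give matching bounds on the number of edits, so from here on
  only symmetric differences need counting.\<close>

lemma edit_distance_eq_card_sym_diff:
  assumes "finite V" "E \<subseteq> all_edges V" "F \<subseteq> all_edges V"
  shows "edit_distance V E F = card (sym_diff E F)"
  unfolding edit_distance_def
  by (rule Least_equality)
    (use edits_of_card_sym_diff[OF assms] card_sym_diff_le_edits in blast)+

text \<open>Removed and added edges are kept apart because the switching of a bridge lowers one
  count and raises the other.\<close>

lemma smoothing_ball_iff:
  assumes "finite V" "E \<subseteq> all_edges V"
  shows "F \<in> smoothing_ball V k E \<longleftrightarrow> F \<in> connected_graphs V \<and> card (E - F) + card (F - E) \<le> k"
proof -
  have "card (sym_diff E F) = card (E - F) + card (F - E)" if "F \<subseteq> all_edges V"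
    using finite_all_edges[OF assms(1)] assms(2) that
    by (intro card_Un_disjoint) (auto intro: finite_subset)
  then show ?thesis
    using edit_distance_eq_card_sym_diff[OF assms] unfolding smoothing_ball_def connected_graphs_def by auto
qed

lemma finite_smoothing_ball: "finite V \<Longrightarrow> finite (smoothing_ball V k E)"
  unfolding smoothing_ball_def connected_graphs_def
  by (rule finite_subset[of _ "Pow (all_edges V)"]) (auto intro: finite_all_edges)

lemma center_in_smoothing_ball:
  "\<lbrakk>finite V; E \<in> connected_graphs V\<rbrakk> \<Longrightarrow> E \<in> smoothing_ball V k E"
  using smoothing_ball_iff[of V E E] unfolding connected_graphs_def by auto

section \<open>Connectivity and the exchange of bridges\<close>

lemma sym_adj_rtrancl: "sym ((adj E)\<^sup>*)"
  by (rule sym_rtrancl) (auto simp: sym_def adj_def insert_commute)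

lemma connected_graphs_supset:
  assumes "E \<in> connected_graphs V" "E \<subseteq> F" "F \<subseteq> all_edges V"
  shows "F \<in> connected_graphs V"
proof -
  have "(adj E)\<^sup>* \<subseteq> (adj F)\<^sup>*"
    using assms(2) by (intro rtrancl_mono) (auto simp: adj_def)
  then show ?thesis using assms unfolding connected_graphs_def by blast
qed

text \<open>Deleting the bridge \<open>e\<close> splits \<open>F\<close> into two components. The
  connected graph \<open>E\<close> has an edge across this cut, and that edge is not in
  \<open>F\<close>, whose only crossing edge \<open>e\<close> is missing from
  \<open>E\<close>.\<close>

lemma replace_bridge:
  assumes E: "E \<in> connected_graphs V" and F: "F \<in> connected_graphs V"
    and e: "e \<in> F" "e \<notin> E" and nc: "F - {e} \<notin> connected_graphs V"
  shows "\<exists>f\<in>E - F. insert f (F - {e}) \<in> connected_graphs V"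
proof -
  let ?R = "(adj (F - {e}))\<^sup>*"
  have FV: "F \<subseteq> all_edges V" and EV: "E \<subseteq> all_edges V"
    using E F unfolding connected_graphs_def by auto
  obtain a b where ab: "e = {a, b}" "a \<in> V" "b \<in> V"
    using e FV unfolding all_edges_def by (auto simp: card_2_iff)
  \<comment> \<open>All edges of \<open>F\<close> other than \<open>e\<close> survive, so a path
    between the endpoints of \<open>e\<close> restores connectivity.\<close>
  have conn_if: "insert f (F - {e}) \<in> connected_graphs V"
    if f: "insert f (F - {e}) \<subseteq> all_edges V" "(a, b) \<in> (adj (insert f (F - {e})))\<^sup>*" for f
  proof -
    let ?Q = "(adj (insert f (F - {e})))\<^sup>*"
    have "(b, a) \<in> ?Q" using f(2) sym_adj_rtrancl by (metis symD)
    then have "adj F \<subseteq> ?Q"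
      using f(2) ab(1) unfolding adj_def by (auto simp: doubleton_eq_iff)
    then have "(adj F)\<^sup>* \<subseteq> ?Q" by (metis rtrancl_subset_rtrancl)
    then show ?thesis using F f(1) unfolding connected_graphs_def by blast
  qed
  have nab: "(a, b) \<notin> ?R"
  proof
    assume "(a, b) \<in> ?R"
    then have "(b, a) \<in> ?R" using sym_adj_rtrancl by (metis symD)
    then have "adj F \<subseteq> ?R"
      using \<open>(a, b) \<in> ?R\<close> ab(1) unfolding adj_def by (auto simp: doubleton_eq_iff)
    then have "(adj F)\<^sup>* \<subseteq> ?R" by (metis rtrancl_subset_rtrancl)
    then show False using F FV nc unfolding connected_graphs_def by blast
  qed
  \<comment> \<open>\<open>F - {e}\<close> has at most two components, those of \<open>a\<close> and
    \<open>b\<close>.\<close>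
  have split: "(a, w) \<in> ?R \<or> (b, w) \<in> ?R" if "(a, w) \<in> (adj F)\<^sup>*" for w
    using that
  proof induction
    case (step y z)
    show ?case
    proof (cases "{y, z} = e")
      case True
      then show ?thesis using ab by (auto simp: doubleton_eq_iff)
    next
      case False
      then have "(y, z) \<in> adj (F - {e})" using step unfolding adj_def by auto
      then show ?thesis using step.IH by (meson rtrancl.rtrancl_into_rtrancl)
    qed
  qed auto
  \<comment> \<open>Otherwise the component of \<open>a\<close> would be closed under the edges of
    \<open>E\<close> and hence contain \<open>b\<close>.\<close>
  have "\<exists>x y. (x, y) \<in> adj E \<and> (a, x) \<in> ?R \<and> (a, y) \<notin> ?R"
  proof (rule ccontr)
    assume *: "\<not> ?thesis"
    have "(a, w) \<in> ?R" if "(a, w) \<in> (adj E)\<^sup>*" for w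
      using that by induction (use * in auto)
    then show False using nab E ab unfolding connected_graphs_def by auto
  qed
  then obtain x y where xy: "{x, y} \<in> E" "(a, x) \<in> ?R" "(a, y) \<notin> ?R" unfolding adj_def by auto
  have yV: "y \<in> V" using xy(1) EV unfolding all_edges_def by auto
  have "{x, y} \<notin> F"
  proof
    assume "{x, y} \<in> F"
    then have "(x, y) \<in> adj (F - {e})" using xy e unfolding adj_def by auto
    then show False using xy by (meson rtrancl.rtrancl_into_rtrancl)
  qed
  moreover have "(a, b) \<in> (adj (insert {x, y} (F - {e})))\<^sup>*"
  proof -
    let ?Q = "(adj (insert {x, y} (F - {e})))\<^sup>*"
    have RQ: "?R \<subseteq> ?Q" by (intro rtrancl_mono) (auto simp: adj_def)
    have "(b, y) \<in> ?R" using split[of y] xy(3) F ab yV unfolding connected_graphs_def by auto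
    then have "(y, b) \<in> ?Q" using sym_adj_rtrancl RQ by (metis subsetD symD)
    moreover have "(x, y) \<in> ?Q" by (auto simp: adj_def)
    ultimately show ?thesis using RQ xy(2) by (meson rtrancl_trans subsetD)
  qed
  ultimately show ?thesis
    using conn_if[of "{x, y}"] xy(1) EV FV by blast
qed

subsection \<open>Probability of a new edge\<close>

locale smoothing_center =
  fixes V :: "'a set" and k :: nat and E :: "'a graph"
  assumes finite_V: "finite V" and connected_E: "E \<in> connected_graphs V"
begin

lemma E_subset: "E \<subseteq> all_edges V"
  using connected_E unfolding connected_graphs_def by auto

lemma finite_graph: "F \<subseteq> all_edges V \<Longrightarrow> finite F"
  using finite_all_edges[OF finite_V] by (rule finite_subset[rotated])

lemma in_ball_iff:
  "F \<in> smoothing_ball V k E \<longleftrightarrow> F \<in> connected_graphs V \<and> card (E - F) + card (F - E) \<le> k"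
  by (rule smoothing_ball_iff[OF finite_V E_subset])

lemma in_ballD:
  assumes "F \<in> smoothing_ball V k E"
  shows "F \<subseteq> all_edges V" "finite F" "card (F - E) \<le> k"
  using assms finite_graph[of F] unfolding in_ball_iff connected_graphs_def by auto

text \<open>The supply of fresh edges, those in neither \<open>E\<close> nor \<open>F\<close>, on
  which both switchings draw; \<open>F\<close> adds at most \<open>k\<close> edges to
  \<open>E\<close>.\<close>

lemma card_new_edges_ge:
  assumes "F \<in> smoothing_ball V k E" "m + card E + k \<le> card (all_edges V)"
  shows "m \<le> card (all_edges V - (E \<union> F))"
proof -
  have "card (E \<union> F) \<le> card E + k"
    using card_Un_le[of E "F - E"] in_ballD[OF assms(1)] by simp
  moreover have "card (all_edges V - (E \<union> F)) = card (all_edges V) - card (E \<union> F)"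
    using E_subset in_ballD[OF assms(1)] finite_graph by (intro card_Diff_subset) auto
  ultimately show ?thesis using assms(2) by simp
qed

text \<open>Double counting of the switching that swaps \<open>e\<close> for a fresh edge
  \<open>e'\<close>, which leaves the distance to \<open>E\<close> unchanged. Each \<open>F\<close>
  allows at least \<open>m\<close> switchings, and each resulting graph offers at most
  \<open>k\<close> candidates for \<open>e'\<close> among its added edges.\<close>

lemma card_with_nonbridge_le:
  assumes e: "e \<notin> E" and m: "m + card E + k \<le> card (all_edges V)"
  shows "card {F \<in> smoothing_ball V k E. e \<in> F \<and> F - {e} \<in> connected_graphs V} * m
    \<le> card (smoothing_ball V k E) * k"
proof -
  define B where "B = smoothing_ball V k E"
  define A where "A = {F \<in> B. e \<in> F \<and> F - {e} \<in> connected_graphs V}"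
  define S where "S = Sigma A (\<lambda>F. all_edges V - (E \<union> F))"
  define T where "T = Sigma B (\<lambda>F. F - E)"
  \<comment> \<open>Recording \<open>e'\<close> makes the switching reversible: delete
    \<open>e'\<close> and put \<open>e\<close> back.\<close>
  define h where "h = (\<lambda>(F, e'). (insert e' (F - {e}), e'))"
  have finB: "finite B" unfolding B_def by (rule finite_smoothing_ball[OF finite_V])
  then have finA: "finite A" unfolding A_def by simp
  have finT: "finite T" unfolding T_def
    using finB in_ballD(2) by (intro finite_SigmaI) (auto simp: B_def)
  have inj: "inj_on h S"
  proof (rule inj_onI)
    fix p q assume pq: "p \<in> S" "q \<in> S" "h p = h q"
    obtain F f F' where p: "p = (F, f)" "q = (F', f)"
      using pq(3) unfolding h_def by (auto split: prod.splits)
    have *: "e \<in> F" "e \<in> F'" "f \<notin> F" "f \<notin> F'" "insert f (F - {e}) = insert f (F' - {e})"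
      using pq p unfolding S_def A_def h_def by auto
    have "F = insert e (insert f (F - {e}) - {f})" using *(1,3) by auto
    also have "\<dots> = insert e (insert f (F' - {e}) - {f})" using *(5) by simp
    also have "\<dots> = F'" using *(2,4) by auto
    finally have "F = F'" .
    then show "p = q" using p by simp
  qed
  have img: "h ` S \<subseteq> T"
  proof (rule image_subsetI)
    fix p assume "p \<in> S"
    then obtain F f where p: "p = (F, f)" "(F, f) \<in> S" by (cases p) auto
    then have F: "F \<in> B" "e \<in> F" "F - {e} \<in> connected_graphs V"
      and f: "f \<in> all_edges V" "f \<notin> E" "f \<notin> F"
      unfolding S_def A_def by auto
    have "F \<subseteq> all_edges V" "finite F" using in_ballD F(1) unfolding B_def by blast+
    have Fk: "card (E - F) + card (F - E) \<le> k" using F(1) unfolding B_def in_ball_iff by blast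
    have 1: "insert f (F - {e}) \<in> connected_graphs V"
      using connected_graphs_supset[OF F(3)] \<open>F \<subseteq> all_edges V\<close> f(1) by blast
    have 2: "E - insert f (F - {e}) = E - F" using e f by auto
    have 3: "insert f (F - {e}) - E = insert f ((F - E) - {e})" using f by auto
    have "card (insert f ((F - E) - {e})) = Suc (card ((F - E) - {e}))"
      using f \<open>finite F\<close> by (intro card_insert_disjoint) auto
    also have "\<dots> = card (F - E)" using F(2) e \<open>finite F\<close> by (intro card_Suc_Diff1) auto
    finally have "insert f (F - {e}) \<in> B"
      unfolding B_def in_ball_iff 2 3 using 1 Fk by simp
    then show "h p \<in> T" unfolding p(1) h_def T_def using f by auto
  qed
  have "card A * m \<le> (\<Sum>F\<in>A. card (all_edges V - (E \<union> F)))"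
    using sum_bounded_below[of A m "\<lambda>F. card (all_edges V - (E \<union> F))"]
      card_new_edges_ge[OF _ m] unfolding A_def B_def by simp
  also have "\<dots> = card S" unfolding S_def
    using finA finite_all_edges[OF finite_V] by (subst card_SigmaI) auto
  also have "\<dots> \<le> card T" by (rule card_inj_on_le[OF inj img finT])
  also have "\<dots> = (\<Sum>F\<in>B. card (F - E))" unfolding T_def
    using finB in_ballD(2) by (subst card_SigmaI) (auto simp: B_def)
  also have "\<dots> \<le> card B * k"
    using sum_bounded_above[of B "\<lambda>F. card (F - E)" k] in_ballD(3) unfolding B_def by simp
  finally show ?thesis unfolding A_def B_def .
qed

text \<open>Here \<open>e\<close> is exchanged for a missing edge of \<open>E\<close>, which saves
  two edits; they pay for two fresh edges. There are at least \<open>m * (m - 1)\<close> ordered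
  choices per \<open>F\<close>, against at most \<open>card E * k * k\<close> possible records per
  resulting graph.\<close>

lemma card_with_bridge_le:
  assumes e: "e \<notin> E" and m: "m + card E + k \<le> card (all_edges V)"
  shows "card {F \<in> smoothing_ball V k E. e \<in> F \<and> F - {e} \<notin> connected_graphs V} * (m * (m - 1))
    \<le> card (smoothing_ball V k E) * (card E * (k * k))"
proof -
  define B where "B = smoothing_ball V k E"
  define A where "A = {F \<in> B. e \<in> F \<and> F - {e} \<notin> connected_graphs V}"
  define N where "N = (\<lambda>F. all_edges V - (E \<union> F))"
  define S where "S = Sigma A (\<lambda>F. Sigma (N F) (\<lambda>e'. N F - {e'}))"
  define T where "T = Sigma B (\<lambda>F. E \<times> (F - E) \<times> (F - E))"
  have "\<forall>F\<in>A. \<exists>f\<in>E - F. insert f (F - {e}) \<in> connected_graphs V"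
    using replace_bridge[OF connected_E _ _ e] unfolding A_def B_def in_ball_iff by auto
  then obtain c where c: "\<And>F. F \<in> A \<Longrightarrow> c F \<in> E - F"
      "\<And>F. F \<in> A \<Longrightarrow> insert (c F) (F - {e}) \<in> connected_graphs V"
    by metis
  \<comment> \<open>The restored edge and both fresh edges are recorded, so that \<open>F\<close>
    can be recovered.\<close>
  define h where
    "h = (\<lambda>(F, e', e''). (insert e'' (insert e' (insert (c F) (F - {e}))), c F, e', e''))"
  have finB: "finite B" unfolding B_def by (rule finite_smoothing_ball[OF finite_V])
  then have finA: "finite A" unfolding A_def by simp
  have finN: "finite (N F)" for F unfolding N_def using finite_all_edges[OF finite_V] by simp
  have finE: "finite E" using E_subset finite_graph by blast
  have finT: "finite T" unfolding T_def
    using finB finE in_ballD(2) by (intro finite_SigmaI) (auto simp: B_def)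
  have inj: "inj_on h S"
  proof (rule inj_onI)
    fix p q assume pq: "p \<in> S" "q \<in> S" "h p = h q"
    obtain F f g F' where p: "p = (F, f, g)" "q = (F', f, g)" and cc: "c F = c F'"
      using pq(3) unfolding h_def by (auto split: prod.splits)
    have A: "F \<in> A" "F' \<in> A" using pq p unfolding S_def by auto
    have *: "e \<in> F" "e \<in> F'" "f \<notin> F" "f \<notin> F'" "g \<notin> F" "g \<notin> F'"
      "insert g (insert f (insert (c F) (F - {e}))) = insert g (insert f (insert (c F) (F' - {e})))"
      using pq p cc unfolding S_def A_def h_def N_def by auto
    have **: "c F \<notin> F" "c F \<notin> F'" using c(1)[OF A(1)] c(1)[OF A(2)] cc by auto
    have "F = insert e (insert g (insert f (insert (c F) (F - {e}))) - {g, f, c F})"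
      using *(1,3,5) ** by auto
    also have "\<dots> = insert e (insert g (insert f (insert (c F) (F' - {e}))) - {g, f, c F})"
      using *(7) by simp
    also have "\<dots> = F'" using *(2,4,6) ** by auto
    finally have "F = F'" .
    then show "p = q" using p by simp
  qed
  have img: "h ` S \<subseteq> T"
  proof (rule image_subsetI)
    fix p assume "p \<in> S"
    then obtain F f g where p: "p = (F, f, g)" "(F, f, g) \<in> S" by (cases p) auto
    then have FA: "F \<in> A" and F: "F \<in> B" "e \<in> F"
      and f: "f \<in> all_edges V" "f \<notin> E" "f \<notin> F" and g: "g \<in> all_edges V" "g \<notin> E" "g \<notin> F" "g \<noteq> f"
      unfolding S_def A_def N_def by auto
    have FV: "F \<subseteq> all_edges V" "finite F" using in_ballD F(1) unfolding B_def by blast+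
    have Fk: "card (E - F) + card (F - E) \<le> k" using F(1) unfolding B_def in_ball_iff by blast
    have cF: "c F \<in> E" "c F \<notin> F" using c(1)[OF FA] by auto
    let ?F = "insert g (insert f (insert (c F) (F - {e})))"
    have 1: "?F \<in> connected_graphs V"
      using connected_graphs_supset[OF c(2)[OF FA], of ?F] FV f(1) g(1) cF E_subset by blast
    have 2: "E - ?F = (E - F) - {c F}" using e f g by auto
    have 3: "?F - E = insert g (insert f ((F - E) - {e}))" using f g cF by auto
    have "card (insert g (insert f ((F - E) - {e}))) = Suc (Suc (card ((F - E) - {e})))"
      using f g FV by simp
    also have "\<dots> = Suc (card (F - E))"
      using card_Suc_Diff1[of "F - E" e] F(2) e FV by auto
    finally have "card (?F - E) = Suc (card (F - E))" unfolding 3 .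
    \<comment> \<open>One removal fewer balances one addition more, so the result stays in the
      ball.\<close>
    moreover have "Suc (card (E - ?F)) = card (E - F)"
      unfolding 2 using cF finE by (intro card_Suc_Diff1) auto
    ultimately have "?F \<in> B" unfolding B_def in_ball_iff using 1 Fk by linarith
    then show "h p \<in> T" unfolding p(1) h_def T_def using f g cF by auto
  qed
  have Nm: "m \<le> card (N F)" if "F \<in> A" for F
    using card_new_edges_ge[OF _ m] that unfolding A_def B_def N_def by simp
  have inner: "card (Sigma (N F) (\<lambda>e'. N F - {e'})) = card (N F) * (card (N F) - 1)" for F
    using finN by (subst card_SigmaI) auto
  have "card A * (m * (m - 1)) \<le> (\<Sum>F\<in>A. card (Sigma (N F) (\<lambda>e'. N F - {e'})))"
    unfolding inner using Nm
    by (intro sum_bounded_below[of A "m * (m - 1)", simplified of_nat_id]) (auto intro!: mult_mono diff_le_mono)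
  also have "\<dots> = card S" unfolding S_def
    using finA finN by (subst card_SigmaI) auto
  also have "\<dots> \<le> card T" by (rule card_inj_on_le[OF inj img finT])
  also have "\<dots> = (\<Sum>F\<in>B. card (E \<times> (F - E) \<times> (F - E)))" unfolding T_def
    using finB finE in_ballD(2) by (subst card_SigmaI) (auto simp: B_def)
  also have "\<dots> \<le> card B * (card E * (k * k))"
    using in_ballD(3)
    by (intro sum_bounded_above[of B _ "card E * (k * k)", simplified of_nat_id])
       (auto simp: B_def card_cartesian_product intro!: mult_mono)
  finally show ?thesis unfolding A_def B_def .
qed

text \<open>The switching bounds with \<open>m\<close> of order \<open>n^2\<close>: nonbridges
  contribute \<open>4 * k / n^2\<close> and bridges \<open>32 * k / n^2\<close>.\<close>

lemma prob_new_edge_le: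
  assumes n: "card V = n" "n \<ge> 20" "k \<le> n" and E: "card E \<le> 2 * n" and e: "e \<notin> E"
  shows "measure_pmf.prob (pmf_of_set (smoothing_ball V k E)) {F. e \<in> F} \<le> 36 * real k / (real n)\<^sup>2"
proof -
  define B where "B = smoothing_ball V k E"
  define A1 where "A1 = {F \<in> B. e \<in> F \<and> F - {e} \<in> connected_graphs V}"
  define A2 where "A2 = {F \<in> B. e \<in> F \<and> F - {e} \<notin> connected_graphs V}"
  have finB: "finite B" and neB: "B \<noteq> {}"
    unfolding B_def using finite_smoothing_ball[OF finite_V]
      center_in_smoothing_ball[OF finite_V connected_E] by auto
  define m where "m = card (all_edges V) - card E - k"
  have "card (all_edges V) = n choose 2"
    unfolding all_edges_def using n_subsets[OF finite_V, of 2] n(1) by simp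
  then have N: "real (card (all_edges V)) = n * (n - 1) / 2"
    using n(2) by (simp add: choose_two real_of_nat_div of_nat_diff)
  have big: "real n * real n \<ge> 20 * real n" using n(2) by simp
  have "real (card E + k) \<le> 3 * n" using E n(3) by simp
  \<comment> \<open>This is where \<open>n \<ge> 20\<close> enters; the summand 1 ensures that
    \<open>m - 1\<close> is also at least \<open>n^2 / 4\<close>.\<close>
  moreover have "(real n)\<^sup>2 / 4 + 1 + 3 * real n \<le> n * (n - 1) / 2"
  proof -
    have "real (n * (n - 1)) = real n * real n - real n"
      using n(2) by (simp add: of_nat_diff algebra_simps)
    moreover have "real n \<ge> 20" using n(2) by simp
    ultimately show ?thesis using big unfolding power2_eq_square by linarith
  qed
  ultimately have "real (card E + k) + ((real n)\<^sup>2 / 4 + 1) \<le> real (card (all_edges V))"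
    using N by linarith
  moreover from this have mle: "m + card E + k \<le> card (all_edges V)"
    unfolding m_def using zero_le_power2[of "real n"] by linarith
  ultimately have m: "(real n)\<^sup>2 / 4 + 1 \<le> real m"
    unfolding m_def by (simp add: of_nat_diff)
  then have m1: "(real n)\<^sup>2 / 4 \<le> real (m - 1)" by (simp add: of_nat_diff)
  have n0: "real n > 0" using n(2) by simp
  have cB: "real (card B) > 0" using finB neB by (simp add: card_gt_0_iff)
  have "real (card A1) * ((real n)\<^sup>2 / 4) \<le> real (card A1) * real m"
    using m by (intro mult_left_mono) auto
  also have "\<dots> \<le> real (card B) * k"
    using card_with_nonbridge_le[OF e mle] unfolding A1_def B_def of_nat_mult[symmetric] of_nat_le_iff .
  finally have p1: "real (card A1) / card B \<le> 4 * real k / (real n)\<^sup>2"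
    using cB n0 by (simp add: field_simps)
  have "real (card A2) * (((real n)\<^sup>2 / 4) * ((real n)\<^sup>2 / 4)) \<le> real (card A2) * (real m * real (m - 1))"
    using m m1 by (intro mult_left_mono mult_mono) auto
  also have "\<dots> \<le> real (card B) * (card E * (real k * k))"
    using card_with_bridge_le[OF e mle] unfolding A2_def B_def of_nat_mult[symmetric] of_nat_le_iff .
  \<comment> \<open>One factor \<open>k\<close> is given up for \<open>n\<close>, which leaves a
    bound linear in \<open>k\<close>.\<close>
  also have "\<dots> \<le> real (card B) * ((2 * n) * (real k * n))"
    using E n(3) by (intro mult_left_mono mult_mono) (auto simp flip: of_nat_mult)
  finally have p2: "real (card A2) / card B \<le> 32 * real k / (real n)\<^sup>2"
    using cB n0 by (simp add: field_simps power2_eq_square)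
  have "B \<inter> {F. e \<in> F} = A1 \<union> A2" unfolding A1_def A2_def by auto
  moreover have "card (A1 \<union> A2) = card A1 + card A2"
    using finB unfolding A1_def A2_def by (intro card_Un_disjoint) auto
  ultimately have "measure_pmf.prob (pmf_of_set B) {F. e \<in> F} = (card A1 + card A2) / card B"
    using measure_pmf_of_set[OF neB finB] by simp
  also have "\<dots> \<le> 36 * real k / (real n)\<^sup>2" using p1 p2 by (simp add: add_divide_distrib)
  finally show ?thesis unfolding B_def .
qed

end

subsection \<open>Flooding on the spooling graph\<close>

text \<open>Meant for an informed \<open>u\<close> other than the right-hand center
  \<open>i + 1\<close>: in each remaining case \<open>v\<close> is at most
  \<open>i + 1\<close>.\<close>

lemma spool_edge_cases:
  assumes "{u, v} \<in> spool n i"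
  shows "u \<le> i \<and> v \<le> i + 1 \<or> u = i + 1 \<or> v = i + 1"
  using assms unfolding spool_def star_def by (auto simp: doubleton_eq_iff)

lemma spool_subset_all_edges:
  assumes "1 \<le> i" "i < n"
  shows "spool n i \<subseteq> all_edges {1..n}"
  using assms unfolding spool_def star_def all_edges_def by (auto simp: card_insert_if)

lemma card_spool_le:
  assumes "1 \<le> i" "i < n"
  shows "card (spool n i) \<le> 2 * n"
proof -
  have "spool n i \<subseteq> (\<lambda>v. {i, v}) ` {1..n} \<union> (\<lambda>v. {i+1, v}) ` {1..n}"
    using assms unfolding spool_def star_def by auto
  then have "card (spool n i) \<le> card ((\<lambda>v. {i, v}) ` {1..n} \<union> (\<lambda>v. {i+1, v}) ` {1..n})"
    by (rule card_mono[rotated]) simp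
  also have "\<dots> \<le> card ((\<lambda>v. {i, v}) ` {1..n}) + card ((\<lambda>v. {i+1, v}) ` {1..n})"
    by (rule card_Un_le)
  also have "\<dots> \<le> n + n"
    by (intro add_mono) (use card_image_le[of "{1..n}"] in auto)
  finally show ?thesis by simp
qed

lemma spool_connected:
  assumes "1 \<le> i" "i < n"
  shows "spool n i \<in> connected_graphs {1..n}"
proof -
  let ?R = "(adj (spool n i))\<^sup>*"
  have mid: "(i, i + 1) \<in> adj (spool n i)" unfolding adj_def spool_def by auto
  have "(i, v) \<in> ?R" if "v \<in> {1..n}" for v
  proof -
    have "v = i \<or> v = i + 1 \<or> v \<in> {1..i} - {i} \<or> v \<in> {i+1..n} - {i+1}"
      using that by auto
    then consider "v = i" | "v = i + 1" | "v \<in> {1..i} - {i}" | "v \<in> {i+1..n} - {i+1}"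
      by blast
    then show ?thesis
    proof cases
      case 3
      then have "(i, v) \<in> adj (spool n i)" unfolding adj_def spool_def star_def by blast
      then show ?thesis by blast
    next
      case 4
      then have "(i + 1, v) \<in> adj (spool n i)" unfolding adj_def spool_def star_def by blast
      with mid show ?thesis by (meson converse_rtrancl_into_rtrancl r_into_rtrancl)
    qed (use mid in auto)
  qed
  then have "(u, v) \<in> ?R" if "u \<in> {1..n}" "v \<in> {1..n}" for u v
    using that sym_adj_rtrancl by (meson rtrancl_trans symD)
  then show ?thesis
    using spool_subset_all_edges[OF assms] unfolding connected_graphs_def by auto
qed

text \<open>A superset of the informed nodes as long as no right-hand center is reached early: the only
  spool edge that counts is the one that informs the center \<open>r + 2\<close> in round \<open>r + 1\<close>.\<close>

fun spread :: "nat \<Rightarrow> nat dynamic_graph \<Rightarrow> nat \<Rightarrow> nat set" where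
  "spread n H 0 = {1}"
| "spread n H (Suc r) = insert (r + 2) (spread n H r) \<union>
     {v \<in> {1..n}. \<exists>u\<in>{1..n}. u \<in> spread n H r \<and> {u, v} \<in> H (Suc r) - spool n (Suc r)}"

lemma initial_segment_subset_spread: "{1..r + 1} \<subseteq> spread n H r"
proof (induction r)
  case (Suc r)
  have "{1..Suc r + 1} = insert (r + 2) {1..r + 1}" by auto
  then show ?case using Suc by auto
qed simp

text \<open>The spread up to round \<open>r\<close> ignores later rounds, which is the source of
  independence below.\<close>

lemma spread_cong: "(\<And>i. i \<in> {1..r} \<Longrightarrow> H i = H' i) \<Longrightarrow> spread n H r = spread n H' r"
  by (induction r) auto

lemma informed_subset_spread:
  assumes "\<And>s. s \<in> {1..r} \<Longrightarrow> H s \<subseteq> all_edges {1..n}"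
    and "\<And>s. s < r \<Longrightarrow> s + 2 \<notin> spread n H s"
  shows "informed 1 H r \<subseteq> spread n H r"
  using assms
proof (induction r)
  case (Suc r)
  have IH: "informed 1 H r \<subseteq> spread n H r" using Suc.IH Suc.prems by simp
  have "v \<in> spread n H (Suc r)" if u: "u \<in> informed 1 H r" and e: "{u, v} \<in> H (Suc r)" for u v
  proof -
    have u': "u \<in> spread n H r" "u \<noteq> r + 2" using u IH Suc.prems(2)[of r] by auto
    have uv: "u \<in> {1..n}" "v \<in> {1..n}"
      using Suc.prems(1)[of "Suc r"] e unfolding all_edges_def by auto
    show ?thesis
    proof (cases "{u, v} \<in> spool n (Suc r)")
      case True
      \<comment> \<open>Since \<open>u\<close> is not the right-hand center \<open>r + 2\<close>,
        the spool edge stays inside the initial segment, which \<open>spread\<close> contains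
        anyway.\<close>
      then have "v \<le> r + 2" using spool_edge_cases[of u v n "Suc r"] u'(2) by auto
      then have "v \<in> {1..Suc r + 1}" using uv by auto
      then show ?thesis using initial_segment_subset_spread by blast
    next
      case False
      then show ?thesis using e u' uv by auto
    qed
  qed
  then show ?case using IH by auto
qed simp

text \<open>After any round \<open>r \<le> R\<close> the node \<open>r + 2\<close> is a witness of
  incompleteness, and \<open>R + 2 \<le> n\<close> makes it a node of the graph.\<close>

lemma not_completes_before:
  assumes "R + 2 \<le> n" "T < real R + 1"
    and H: "\<And>s. s \<in> {1..R} \<Longrightarrow> H s \<subseteq> all_edges {1..n}"
    and late: "\<And>s. s \<le> R \<Longrightarrow> s + 2 \<notin> spread n H s"
  shows "\<not> completes_before {1..n} 1 H T"
proof
  assume "completes_before {1..n} 1 H T"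
  then obtain r where r: "{1..n} \<subseteq> informed 1 H r" "real r < T"
    unfolding completes_before_def completes_in_round_def by auto
  have "r \<le> R" using r(2) assms(2) by linarith
  then have "informed 1 H r \<subseteq> spread n H r"
    using assms by (intro informed_subset_spread) auto
  moreover have "r + 2 \<in> {1..n}" using \<open>r \<le> R\<close> assms(1) by auto
  ultimately show False using late[OF \<open>r \<le> R\<close>] r(1) by blast
qed

section \<open>Independence of rounds and transmission along new edges\<close>

text \<open>Abstracts from uniform sampling: besides independence of the rounds, only a common bound
  \<open>p\<close> on the probability of each new edge is kept.\<close>

locale spool_smoothing =
  fixes D :: "nat \<Rightarrow> nat graph pmf" and n R :: nat and p :: real
  assumes R: "R + 2 \<le> n" and p_nonneg: "0 \<le> p"
    and prob_new_edge: "\<And>r e. r \<in> {1..R} \<Longrightarrow> e \<notin> spool n r \<Longrightarrow> measure_pmf.prob (D r) {F. e \<in> F} \<le> p"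
begin

abbreviation N :: "nat \<Rightarrow> nat graph measure" where "N r \<equiv> measure_pmf (D r)"

abbreviation M :: "nat dynamic_graph measure" where "M \<equiv> \<Pi>\<^sub>M r\<in>{1..}. N r"

sublocale prob_space M
  by (intro prob_space_PiM) (simp add: prob_space_measure_pmf)

lemma measurable_edge:
  assumes "r \<in> A"
  shows "Measurable.pred (PiM A N) (\<lambda>H. e \<in> H r)"
  by (rule measurable_compose[OF measurable_component_singleton[OF assms]]) simp

text \<open>The index set \<open>A\<close> stays general because both \<open>{1..r}\<close>, for the
  independence argument, and \<open>{1..}\<close> are needed.\<close>

lemma measurable_spread:
  assumes "{1..r} \<subseteq> A"
  shows "Measurable.pred (PiM A N) (\<lambda>H. v \<in> spread n H r)"
  using assms
proof (induction r arbitrary: v)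
  case (Suc r)
  have [measurable]: "Measurable.pred (PiM A N) (\<lambda>H. u \<in> spread n H r)" for u
    using Suc.prems by (intro Suc.IH) auto
  have [measurable]: "Measurable.pred (PiM A N) (\<lambda>H. e \<in> H (Suc r))" for e
    using Suc.prems by (intro measurable_edge) auto
  show ?case by simp
qed simp

lemma coordinates_indep: "indep_vars N (\<lambda>i H. H i) {1..}"
proof (rule indep_vars_iff_distr_eq_PiM'[THEN iffD2])
  have "distr M M (\<lambda>H. \<lambda>i\<in>{1..}. H i) = distr M M (\<lambda>H. H)"
    by (intro distr_cong) (auto simp: space_PiM PiE_def extensional_restrict)
  also have "\<dots> = M" by (rule distr_id)
  also have "\<dots> = PiM {1..} (\<lambda>i. distr M (N i) (\<lambda>H. H i))"
    by (intro PiM_cong refl, subst distr_PiM_component) (auto simp: prob_space_measure_pmf)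
  finally show "distr M (PiM {1..} N) (\<lambda>H. \<lambda>i\<in>{1..}. H i) = PiM {1..} (\<lambda>i. distr M (N i) (\<lambda>H. H i))" .
qed auto

lemma prob_component:
  assumes "r \<ge> 1"
  shows "\<P>(H in M. H r \<in> X) = measure_pmf.prob (D r) X"
proof -
  have "measure (distr M (N r) (\<lambda>H. H r)) X = measure M ((\<lambda>H. H r) -` X \<inter> space M)"
    using assms by (intro measure_distr) (auto intro: measurable_component_singleton)
  moreover have "distr M (N r) (\<lambda>H. H r) = N r"
    using assms by (intro distr_PiM_component) (auto simp: prob_space_measure_pmf)
  moreover have "(\<lambda>H. H r) -` X \<inter> space M = {H \<in> space M. H r \<in> X}" by auto
  ultimately show ?thesis by simp
qed

text \<open>The spread after round \<open>r\<close> depends on rounds \<open>1..r\<close> only and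
  the edge on round \<open>Suc r\<close> only, so the two events are independent.\<close>

lemma prob_transmission_le:
  assumes "Suc r \<le> R"
  shows "\<P>(H in M. u \<in> spread n H r \<and> e \<in> H (Suc r) - spool n (Suc r))
    \<le> \<P>(H in M. u \<in> spread n H r) * p"
proof (cases "e \<in> spool n (Suc r)")
  case True
  then show ?thesis using p_nonneg by simp
next
  case False
  define X where "X = {H \<in> space (PiM {1..r} N). u \<in> spread n H r}"
  define Y where "Y = {H \<in> space (PiM {Suc r} N). e \<in> H (Suc r)}"
  have X: "X \<in> sets (PiM {1..r} N)"
    unfolding X_def using measurable_spread[of r "{1..r}" u] by (simp add: pred_def)
  have Y: "Y \<in> sets (PiM {Suc r} N)"
    unfolding Y_def using measurable_edge[of "Suc r" "{Suc r}" e] by (simp add: pred_def)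
  have X': "(\<lambda>H. restrict (\<lambda>i. H i) {1..r}) -` X \<inter> space M = {H \<in> space M. u \<in> spread n H r}"
    using spread_cong[of r "restrict H {1..r}" H n for H] unfolding X_def by (auto simp: space_PiM)
  have Y': "(\<lambda>H. restrict (\<lambda>i. H i) {Suc r}) -` Y \<inter> space M = {H \<in> space M. e \<in> H (Suc r)}"
    unfolding Y_def by (auto simp: space_PiM)
  have "indep_var (PiM {1..r} N) (\<lambda>H. restrict (\<lambda>i. H i) {1..r}) (PiM {Suc r} N) (\<lambda>H. restrict (\<lambda>i. H i) {Suc r})"
    by (rule indep_var_restrict[OF coordinates_indep]) auto
  from indep_varD[OF this X Y]
  have "prob ((\<lambda>H. (restrict (\<lambda>i. H i) {1..r}, restrict (\<lambda>i. H i) {Suc r})) -` (X \<times> Y) \<inter> space M) =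
    \<P>(H in M. u \<in> spread n H r) * \<P>(H in M. e \<in> H (Suc r))"
    unfolding X' Y' .
  also have "(\<lambda>H. (restrict (\<lambda>i. H i) {1..r}, restrict (\<lambda>i. H i) {Suc r})) -` (X \<times> Y) \<inter> space M
    = {H \<in> space M. u \<in> spread n H r \<and> e \<in> H (Suc r) - spool n (Suc r)}"
    using X' Y' False by blast
  also have "\<P>(H in M. e \<in> H (Suc r)) = measure_pmf.prob (D (Suc r)) {F. e \<in> F}"
    using prob_component[of "Suc r" "{F. e \<in> F}"] by simp
  finally show ?thesis
    using prob_new_edge[of "Suc r" e] assms False by (auto intro!: mult_left_mono)
qed

section \<open>Expected growth of the spread and the overtaking probability\<close>

definition spread_prob :: "nat \<Rightarrow> nat \<Rightarrow> real" where "spread_prob r v = \<P>(H in M. v \<in> spread n H r)"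

text \<open>By linearity, the expected number of nodes of \<open>{1..n}\<close> in the spread,
  written without an integral.\<close>

definition mean_spread :: "nat \<Rightarrow> real" where "mean_spread r = (\<Sum>v\<in>{1..n}. spread_prob r v)"

lemma spread_events [measurable]: "{H \<in> space M. v \<in> spread n H r} \<in> events"
  using measurable_spread[of r "{1..}" v] by (auto simp: pred_def)

lemma transmission_events [measurable]:
  "{H \<in> space M. u \<in> spread n H r \<and> e \<in> H (Suc r) - spool n (Suc r)} \<in> events"
proof -
  have [measurable]: "Measurable.pred M (\<lambda>H. u \<in> spread n H r)" by (rule measurable_spread) auto
  have [measurable]: "Measurable.pred M (\<lambda>H. e \<in> H (Suc r))" by (rule measurable_edge) auto
  show ?thesis by measurable
qed

text \<open>A union bound over the possible informers \<open>u\<close>; the middle term accounts for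
  the node inserted with certainty.\<close>

lemma spread_prob_Suc_le:
  assumes "Suc r \<le> R"
  shows "spread_prob (Suc r) v \<le> spread_prob r v + (if v = r + 2 then 1 else 0) + p * mean_spread r"
proof (cases "v = r + 2")
  case True
  have "spread_prob (Suc r) v \<le> 1" unfolding spread_prob_def by (rule prob_le_1)
  moreover have "0 \<le> spread_prob r v" "0 \<le> p * mean_spread r"
    unfolding spread_prob_def mean_spread_def using p_nonneg by (auto intro!: mult_nonneg_nonneg sum_nonneg)
  ultimately show ?thesis using True by simp
next
  case False
  let ?A = "{H \<in> space M. v \<in> spread n H r}"
  let ?B = "\<lambda>u. {H \<in> space M. u \<in> spread n H r \<and> {u, v} \<in> H (Suc r) - spool n (Suc r)}"
  have "spread_prob (Suc r) v \<le> prob (?A \<union> (\<Union>u\<in>{1..n}. ?B u))"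
    unfolding spread_prob_def using False
    by (intro finite_measure_mono sets.Un sets.finite_UN spread_events transmission_events) auto
  also have "\<dots> \<le> prob ?A + prob (\<Union>u\<in>{1..n}. ?B u)"
    by (intro measure_Un_le spread_events sets.finite_UN transmission_events) auto
  also have "prob (\<Union>u\<in>{1..n}. ?B u) \<le> (\<Sum>u\<in>{1..n}. prob (?B u))"
    by (intro finite_measure_subadditive_finite) (use transmission_events in auto)
  also have "\<dots> \<le> (\<Sum>u\<in>{1..n}. spread_prob r u * p)"
    unfolding spread_prob_def by (intro sum_mono prob_transmission_le assms)
  also have "\<dots> = p * mean_spread r" unfolding mean_spread_def by (simp add: sum_distrib_left mult.commute)
  finally show ?thesis using False unfolding spread_prob_def by simp
qed

lemma mean_spread_Suc_le:
  assumes "Suc r \<le> R"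
  shows "mean_spread (Suc r) \<le> mean_spread r * (1 + n * p) + 1"
proof -
  have "mean_spread (Suc r) \<le> (\<Sum>v\<in>{1..n}. spread_prob r v + (if v = r + 2 then 1 else 0) + p * mean_spread r)"
    unfolding mean_spread_def[of "Suc r"] by (intro sum_mono spread_prob_Suc_le assms)
  also have "\<dots> = mean_spread r + (\<Sum>v\<in>{1..n}. if v = r + 2 then 1 else 0) + n * (p * mean_spread r)"
    unfolding mean_spread_def[of r] by (simp add: sum.distrib)
  also have "(\<Sum>v\<in>{1..n}. if v = r + 2 then 1 else (0::real)) \<le> 1"
    by (subst sum.delta) auto
  finally show ?thesis by (simp add: algebra_simps)
qed

lemma mean_spread_0_le: "mean_spread 0 \<le> 1"
proof -
  have "mean_spread 0 = (\<Sum>v\<in>{1..n}. if v = 1 then 1 else 0)"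
    unfolding mean_spread_def spread_prob_def using prob_space by (intro sum.cong) auto
  then show ?thesis by (simp add: sum.delta)
qed

text \<open>Iterates the recursion with factor \<open>x = 1 + n * p\<close>; the added 1 is absorbed
  by \<open>x ^ Suc r\<close>.\<close>

lemma mean_spread_le: "r \<le> R \<Longrightarrow> mean_spread r \<le> (r + 1) * (1 + n * p) ^ r"
proof (induction r)
  case 0
  then show ?case using mean_spread_0_le by simp
next
  case (Suc r)
  let ?x = "1 + n * p"
  have x: "?x \<ge> 1" using p_nonneg by simp
  have "mean_spread (Suc r) \<le> mean_spread r * ?x + 1" using Suc by (intro mean_spread_Suc_le) auto
  also have "\<dots> \<le> ((r + 1) * ?x ^ r) * ?x + ?x ^ Suc r"
    using Suc x by (intro add_mono mult_right_mono one_le_power) (auto simp: add.commute)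
  also have "\<dots> = (Suc r + 1) * ?x ^ Suc r" by (simp add: algebra_simps)
  finally show ?case by (simp add: add.commute)
qed

lemma mean_spread_le_linear:
  assumes "r \<le> R" "R * (n * p) \<le> 1"
  shows "mean_spread r \<le> 3 * (R + 1)"
proof -
  have "(1 + n * p) ^ r \<le> exp (n * p) ^ r"
    using p_nonneg exp_ge_add_one_self[of "n * p"] by (intro power_mono) auto
  also have "\<dots> = exp (r * (n * p))" by (simp add: exp_of_nat_mult)
  also have "\<dots> \<le> exp (R * (n * p))" using assms(1) p_nonneg by (simp add: mult_right_mono)
  also have "\<dots> \<le> exp 1" using assms(2) by simp
  also have "\<dots> \<le> 3" by (rule exp_le)
  finally have "(1 + n * p) ^ r \<le> 3" .
  then have "(r + 1) * (1 + n * p) ^ r \<le> (real R + 1) * 3"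
    using assms(1) p_nonneg by (intro mult_mono) auto
  then show ?thesis using mean_spread_le[OF assms(1)] by (simp add: add.commute)
qed

text \<open>Rounds up to \<open>r\<close> insert only the nodes \<open>2..r + 1\<close> with
  certainty, so \<open>v\<close> can enter by transmission alone, with probability at most
  \<open>p * mean_spread\<close> per round.\<close>

lemma spread_prob_le:
  assumes "r \<le> R" "v \<ge> r + 2" "R * (n * p) \<le> 1"
  shows "spread_prob r v \<le> r * (p * (3 * (R + 1)))"
  using assms(1,2)
proof (induction r)
  case 0
  then show ?case unfolding spread_prob_def by simp
next
  case (Suc r)
  have "spread_prob (Suc r) v \<le> spread_prob r v + p * mean_spread r" using spread_prob_Suc_le[of r v] Suc.prems by simp
  also have "\<dots> \<le> r * (p * (3 * (R + 1))) + p * (3 * (R + 1))"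
    using Suc mean_spread_le_linear[OF _ assms(3), of r] p_nonneg by (intro add_mono mult_left_mono) auto
  finally show ?case by (simp add: algebra_simps)
qed

lemma prob_overtaken_le:
  assumes "R * (n * p) \<le> 1"
  shows "\<P>(H in M. \<exists>s\<le>R. s + 2 \<in> spread n H s) \<le> 6 * p * real R ^ 3"
proof -
  have "{H \<in> space M. \<exists>s\<le>R. s + 2 \<in> spread n H s}
    = (\<Union>s\<in>{1..R}. {H \<in> space M. s + 2 \<in> spread n H s})"
  proof -
    \<comment> \<open>Dropping \<open>s = 0\<close> leaves exactly \<open>R\<close> centers for the
      union bound.\<close>
    have "s + 2 \<notin> spread n H s" if "s = 0" for s H using that by simp
    then have "(\<exists>s\<le>R. s + 2 \<in> spread n H s) \<longleftrightarrow> (\<exists>s\<in>{1..R}. s + 2 \<in> spread n H s)" for H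
      by (metis atLeastAtMost_iff le_neq_implies_less less_one not_less)
    then show ?thesis by auto
  qed
  then have "\<P>(H in M. \<exists>s\<le>R. s + 2 \<in> spread n H s) \<le> (\<Sum>s\<in>{1..R}. spread_prob s (s + 2))"
    unfolding spread_prob_def by (simp only:) (intro finite_measure_subadditive_finite, use spread_events in auto)
  also have "\<dots> \<le> (\<Sum>s\<in>{1..R}. R * (p * (3 * (R + 1))))"
  proof (intro sum_mono)
    fix s assume s: "s \<in> {1..R}"
    then have "spread_prob s (s + 2) \<le> s * (p * (3 * (R + 1)))" using assms by (intro spread_prob_le) auto
    also have "\<dots> \<le> R * (p * (3 * (R + 1)))" using s p_nonneg by (intro mult_right_mono) auto
    finally show "spread_prob s (s + 2) \<le> R * (p * (3 * (R + 1)))" .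
  qed
  also have "\<dots> = R * R * p * 3 * (R + 1)" by simp
  \<comment> \<open>\<open>R + 1 \<le> 2 * R\<close> requires \<open>R \<ge> 1\<close>; for
    \<open>R = 0\<close> both sides vanish.\<close>
  also have "\<dots> \<le> R * R * p * 3 * (2 * R)"
  proof (cases "R = 0")
    case False
    then show ?thesis using p_nonneg by (intro mult_left_mono) auto
  qed simp
  finally show ?thesis by (simp add: power3_eq_cube mult_ac)
qed

lemma completes_before_events:
  "{H \<in> space M. \<not> completes_before {1..n} 1 H T} \<in> events"
proof -
  have [measurable]: "Measurable.pred M (\<lambda>H. v \<in> informed 1 H r)" for v r
  proof (induction r arbitrary: v)
    case (Suc r)
    note Suc [measurable]
    have [measurable]: "Measurable.pred M (\<lambda>H. e \<in> H (Suc r))" for e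
      by (rule measurable_edge) auto
    show ?case unfolding informed.simps Un_iff mem_Collect_eq Bex_def by measurable
  qed simp
  have [measurable]: "Measurable.pred M (\<lambda>H. {1..n} \<subseteq> informed 1 H r)" for r
    unfolding subset_iff by measurable
  show ?thesis
    unfolding completes_before_def completes_in_round_def by measurable
qed

lemma overtaken_events: "{H \<in> space M. \<exists>s\<le>R. s + 2 \<in> spread n H s} \<in> events"
proof -
  have "{H \<in> space M. \<exists>s\<le>R. s + 2 \<in> spread n H s}
    = (\<Union>s\<in>{..R}. {H \<in> space M. s + 2 \<in> spread n H s})" by auto
  then show ?thesis using spread_events by auto
qed

end

section \<open>From overtaking to the completion time, and the choice of constants\<close>

lemma completion_probability_bound:
  assumes R: "R + 2 \<le> n" and p: "0 \<le> p" "R * (n * p) \<le> 1" "6 * p * real R ^ 3 \<le> 1 / 2"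
    and T: "T < real R + 1"
    and n: "n \<ge> 20" and k: "k \<le> n" and pk: "36 * real k / (real n)\<^sup>2 \<le> p"
  shows "\<P>(H in smoothed {1..n} k (spooling_graph n). \<not> completes_before {1..n} 1 H T) \<ge> 1 / 2"
proof -
  define D where "D = (\<lambda>r. pmf_of_set (smoothing_ball {1..n} k (spooling_graph n r)))"
  have conn: "spooling_graph n r \<in> connected_graphs {1..n}" if "r \<ge> 1" for r
    unfolding spooling_graph_def using that n by (intro spool_connected) auto
  interpret spool_smoothing D n R p
  proof
    fix r e assume r: "r \<in> {1..R}" and e: "e \<notin> spool n r"
    \<comment> \<open>\<open>R + 2 \<le> n\<close> keeps the minimum in
      \<open>spooling_graph\<close> at \<open>r\<close> throughout these rounds.\<close>
    have eq: "spooling_graph n r = spool n r"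
      unfolding spooling_graph_def using r R by (auto simp: min_def)
    interpret smoothing_center "{1..n}" k "spool n r"
      by standard (use conn[of r] r eq in auto)
    have "card (spool n r) \<le> 2 * n" using r R by (intro card_spool_le) auto
    then have "measure_pmf.prob (D r) {F. e \<in> F} \<le> 36 * real k / (real n)\<^sup>2"
      unfolding D_def eq using n k e by (intro prob_new_edge_le) auto
    then show "measure_pmf.prob (D r) {F. e \<in> F} \<le> p" using pk by simp
  qed (use R p in auto)
  have M: "smoothed {1..n} k (spooling_graph n) = M" unfolding smoothed_def D_def ..
  \<comment> \<open>The sample space of the product also holds sequences with ill-formed graphs;
    only almost surely are all edges within \<open>{1..n}\<close>, so the final comparison of events
    is almost sure too.\<close>
  have "AE H in M. \<forall>r. r \<in> {1..R} \<longrightarrow> H r \<subseteq> all_edges {1..n}"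
    unfolding AE_all_countable
  proof
    fix r
    show "AE H in M. r \<in> {1..R} \<longrightarrow> H r \<subseteq> all_edges {1..n}"
    proof (cases "r \<in> {1..R}")
      case True
      let ?B = "smoothing_ball {1..n} k (spooling_graph n r)"
      have "finite ?B" by (rule finite_smoothing_ball) simp
      moreover have "?B \<noteq> {}"
        using center_in_smoothing_ball[of "{1..n}"] conn[of r] True by auto
      ultimately have "AE F in N r. F \<subseteq> all_edges {1..n}"
        unfolding D_def AE_measure_pmf_iff by (auto simp: smoothing_ball_def connected_graphs_def)
      then have "AE H in M. H r \<subseteq> all_edges {1..n}"
        using True by (intro AE_PiM_component) (auto simp: prob_space_measure_pmf)
      then show ?thesis by auto
    qed auto
  qed
  then have AE: "AE H in M. (\<not> (\<exists>s\<le>R. s + 2 \<in> spread n H s)) \<longrightarrow> \<not> completes_before {1..n} 1 H T"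
  proof eventually_elim
    case (elim H)
    then show ?case using not_completes_before[OF R T, of H] by blast
  qed
  have "1 / 2 \<le> 1 - \<P>(H in M. \<exists>s\<le>R. s + 2 \<in> spread n H s)"
    using prob_overtaken_le[OF p(2)] p(3) by simp
  also have "\<dots> = \<P>(H in M. \<not> (\<exists>s\<le>R. s + 2 \<in> spread n H s))"
    by (rule prob_neg[symmetric]) (rule overtaken_events)
  also have "\<dots> \<le> \<P>(H in M. \<not> completes_before {1..n} 1 H T)"
    using AE by (intro finite_measure_mono_AE completes_before_events) auto
  finally show ?thesis unfolding M .
qed

theorem theorem5p1:
  shows "\<exists>c::real. c > 0 \<and> (\<exists>n0::nat. \<forall>n\<ge>n0. \<forall>k::nat. 1 \<le> k \<and> real k \<le> sqrt (real n) \<longrightarrow>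
    \<P>(H in smoothed {1..n} k (spooling_graph n).
      \<not> completes_before {1..n} 1 H (c * real n powr (2/3) / real k powr (1/3))) \<ge> 1/2)"
\<comment> \<open>The constant \<open>1 / 36\<close> cancels the 36 in \<open>p\<close>: it makes
  \<open>T * n * p\<close> equal to the cube root of \<open>k^2 / n\<close>, at most 1, and
  \<open>6 * p * T^3\<close> equal to \<open>1 / 216\<close>. The threshold 20 is that of the edge
  probability bound.\<close>
proof (intro exI[of _ "1 / 36"] exI[of _ 20] conjI allI impI)
  fix n k :: nat
  assume n: "n \<ge> 20" and "1 \<le> k \<and> real k \<le> sqrt (real n)"
  then have k: "1 \<le> k" "real k \<le> sqrt n" by auto
  define T where "T = 1 / 36 * real n powr (2/3) / real k powr (1/3)"
  define R where "R = nat \<lfloor>T\<rfloor>"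
  define p where "p = 36 * real k / (real n)\<^sup>2"
  have pos: "real n > 0" "real k > 0" using n k by auto
  have T0: "T \<ge> 0" unfolding T_def by simp
  have RT: "real R \<le> T" "T < real R + 1"
    unfolding R_def using T0 by linarith+
  have "(real n powr (2/3)) ^ 3 = (real n)\<^sup>2" "(real k powr (1/3)) ^ 3 = real k"
    using pos by (simp_all add: powr_power)
  then have T3: "T ^ 3 = (real n)\<^sup>2 / (46656 * real k)"
    unfolding T_def by (simp add: power_divide power_mult_distrib)
  have R3: "real R ^ 3 \<le> (real n)\<^sup>2 / (46656 * real k)"
    unfolding T3[symmetric] using RT by (intro power_mono) auto
  have kn2: "(real k)\<^sup>2 \<le> real n"
    using k(2) by (metis of_nat_0_le_iff real_sqrt_ge_0_iff real_sqrt_pow2 power_mono)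
  have "1 * real k \<le> real k * real k" using k(1) by (intro mult_right_mono) auto
  then have kn: "k \<le> n" using kn2 unfolding power2_eq_square by linarith
  \<comment> \<open>Cubing removes the fractional exponents; \<open>k \<le> sqrt n\<close> then
    enters as \<open>k^2 \<le> n\<close>.\<close>
  have "(real R * (n * p)) ^ 3 = real R ^ 3 * (46656 * real k ^ 3 / real n ^ 3)"
    unfolding p_def using pos by (simp add: field_simps eval_nat_numeral)
  also have "\<dots> \<le> (real n)\<^sup>2 / (46656 * real k) * (46656 * real k ^ 3 / real n ^ 3)"
    by (intro mult_right_mono R3) auto
  also have "\<dots> = (real k)\<^sup>2 / real n" using pos by (simp add: field_simps eval_nat_numeral)
  also have "\<dots> \<le> 1 ^ 3" using kn2 pos by simp
  finally have Rnp: "real R * (n * p) \<le> 1"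
    \<comment> \<open>The rule is stated for exponent \<open>Suc n\<close>, so 2 stands for the
      cube.\<close>
    by (rule power_le_imp_le_base[of _ 2, simplified]) auto
  have "6 * p * real R ^ 3 \<le> 6 * p * ((real n)\<^sup>2 / (46656 * real k))"
    using R3 by (intro mult_left_mono) (auto simp: p_def)
  also have "\<dots> \<le> 1 / 2" unfolding p_def using pos by (simp add: field_simps)
  finally have pR3: "6 * p * real R ^ 3 \<le> 1 / 2" .
  have "T \<le> real n powr (2/3) / 36"
    unfolding T_def using k(1) ge_one_powr_ge_zero[of "real k" "1/3"]
    by (simp add: divide_le_eq mult_le_cancel_left1)
  also have "real n powr (2/3) \<le> real n powr 1" using n by (intro powr_mono) auto
  \<comment> \<open>By now \<open>T \<le> n / 36\<close>, which leaves ample room for the two extra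
    nodes.\<close>
  finally have "real R + 2 \<le> n" using RT n by simp
  then have "R + 2 \<le> n" by linarith
  then show "\<P>(H in smoothed {1..n} k (spooling_graph n). \<not> completes_before {1..n} 1 H
      (1 / 36 * real n powr (2/3) / real k powr (1/3))) \<ge> 1 / 2"
    using completion_probability_bound[OF _ _ Rnp pR3 RT(2) n kn]
    unfolding p_def T_def by simp
qed simp

end
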